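(* Suppose $\phi\in C^1(\mathbb{R}^3)$ is a real-valued map satisfying $$\phi(v_n')+\phi(\overline{v}_n')=\phi(v)+\phi(\overline{v})$$ for all $n\in\mathbb{S}^2$ and all $v,\overline{v}\in\mathbb{R}^3$, where $v_n':=v-((v-\overline{v})\cdot n)\,n$ and $\overline{v}_n':=\overline{v}+((v-\overline{v})\cdot n)\,n$. Then there exist constants $a,c\in\mathbb{R}$ and a vector $b\in\mathbb{R}^3$ such that $$\phi(v)=a+b\cdot v+c|v|^2$$ for all $v\in\mathbb{R}^3$.
   Context: $\mathbb{S}^2$ denotes the unit sphere in $\mathbb{R}^3$, and $\cdot$ and $|\cdot|$ are the Euclidean inner product and norm. *)

theory Defs
  imports "HOL-Analysis.Analysis"
begin

(* The library's C1_differentiable_on only covers curves with a real argument.  Here the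
   Frechet derivative exists everywhere and depends continuously, in the operator norm,
   on the point. *)
definition C1 :: "('a::real_normed_vector \<Rightarrow> 'b::real_normed_vector) \<Rightarrow> bool" where
  "C1 f \<longleftrightarrow>
     (\<exists>D :: 'a \<Rightarrow> 'a \<Rightarrow>\<^sub>L 'b.
        (\<forall>x. (f has_derivative blinfun_apply (D x)) (at x)) \<and> continuous_on UNIV D)"

end

theory Submission
  imports Defs
begin

text \<open>
  Taking \<open>w = 0\<close> and \<open>n\<close> along \<open>x\<close> shows that \<open>\<psi> = \<phi> - \<phi> 0\<close> is additive on orthogonal
  pairs. Rotating a square by 45 degrees then gives \<open>o (2 x) = 2 * o x\<close> for the odd part
  \<open>o\<close>, so \<open>o\<close> equals its derivative at \<open>0\<close>. The even part is constant on spheres, because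
  \<open>(x + z) / 2\<close> and \<open>(x - z) / 2\<close> are orthogonal when \<open>norm x = norm z\<close>; by Pythagoras it is
  an additive function of the squared norm, and differentiability makes that function linear.
\<close>

definition orthogonally_additive :: "('a::real_inner \<Rightarrow> real) \<Rightarrow> bool" where
  "orthogonally_additive f \<longleftrightarrow> (\<forall>x y. orthogonal x y \<longrightarrow> f (x + y) = f x + f y)"

lemma orthogonally_additiveD:
  "orthogonally_additive f \<Longrightarrow> x \<bullet> y = 0 \<Longrightarrow> f (x + y) = f x + f y"
  by (simp add: orthogonally_additive_def orthogonal_def)

text \<open>Along the points \<open>x + s / 2 ^ n\<close>, which tend to \<open>x\<close>, the
  difference quotient is constantly \<open>A / s\<close>, so it equals its limit \<open>D\<close>.
  This turns a mere halving identity into linearity.\<close>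

lemma derivative_eq_dyadic_increment:
  fixes f :: "real \<Rightarrow> real"
  assumes f: "(f has_real_derivative D) (at x)"
    and incr: "\<And>n. f (x + s / 2 ^ n) - f x = A / 2 ^ n"
    and s: "s \<noteq> 0"
  shows "A = D * s"
proof -
  have "(\<lambda>n. s * (1 / 2) ^ n) \<longlonglongrightarrow> s * 0"
    by (intro tendsto_mult tendsto_const LIMSEQ_power_zero) auto
  then have "(\<lambda>n. s / 2 ^ n) \<longlonglongrightarrow> 0"
    by (simp add: power_one_over divide_simps)
  then have "filterlim (\<lambda>n. s / 2 ^ n) (at 0) sequentially"
    using s by (auto simp: filterlim_at)
  moreover have "((\<lambda>h. (f (x + h) - f x) / h) \<longlongrightarrow> D) (at 0)"
    using f by (simp add: DERIV_def)
  ultimately have "(\<lambda>n. (f (x + s / 2 ^ n) - f x) / (s / 2 ^ n)) \<longlonglongrightarrow> D"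
    by (rule filterlim_compose[rotated])
  then have "(\<lambda>n::nat. A / s) \<longlonglongrightarrow> D"
    using s by (simp add: incr)
  then have "A / s = D"
    by (simp add: LIMSEQ_const_iff)
  then show ?thesis
    using s by (simp add: field_simps)
qed

lemma halving_iterate:
  fixes g :: "'a::real_vector \<Rightarrow> real"
  assumes "\<And>x. g (2 *\<^sub>R x) = 2 * g x"
  shows "g ((1 / 2 ^ n) *\<^sub>R x) = g x / 2 ^ n"
proof (induction n)
  case (Suc n)
  have "g ((1 / 2 ^ n) *\<^sub>R x) = 2 * g ((1 / 2 ^ Suc n) *\<^sub>R x)"
    using assms[of "(1 / 2 ^ Suc n) *\<^sub>R x"] by simp
  then show ?case
    using Suc by (simp add: field_simps)
qed simp

lemma exists_orthogonal_same_norm: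
  fixes x :: "'a::euclidean_space"
  assumes "2 \<le> DIM('a)"
  obtains y where "x \<bullet> y = 0" "norm y = norm x"
proof -
  obtain z where z: "z \<noteq> 0" "orthogonal x z"
    using orthogonal_to_vector_exists[OF assms] by blast
  show ?thesis
    using z by (intro that[of "(norm x / norm z) *\<^sub>R z"]) (auto simp: orthogonal_def)
qed

text \<open>In the square with sides \<open>x\<close> and \<open>y\<close>, the diagonals
  \<open>x + y\<close> and \<open>x - y\<close> are orthogonal and sum to
  \<open>2 *\<^sub>R x\<close>. Splitting each diagonal along the sides, the terms
  \<open>f y\<close> and \<open>f (- y)\<close> cancel by oddness.\<close>

lemma orthogonally_additive_odd_double:
  fixes f :: "'a::euclidean_space \<Rightarrow> real"
  assumes f: "orthogonally_additive f" and odd: "\<And>x. f (- x) = - f x"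
    and dim: "2 \<le> DIM('a)"
  shows "f (2 *\<^sub>R x) = 2 * f x"
proof -
  obtain y where y: "x \<bullet> y = 0" "norm y = norm x"
    using exists_orthogonal_same_norm[OF dim] .
  then have sq: "y \<bullet> y = x \<bullet> x"
    by (simp add: norm_eq)
  have "(x + y) \<bullet> (x + - y) = 0"
    using y sq by (simp add: inner_simps inner_commute)
  from orthogonally_additiveD[OF f this] have "f (2 *\<^sub>R x) = f (x + y) + f (x + - y)"
    by (simp add: scaleR_2)
  then show ?thesis
    using orthogonally_additiveD[OF f, of x y] orthogonally_additiveD[OF f, of x "- y"] y odd
    by simp
qed

text \<open>The difference \<open>g\<close> is twice the odd part of \<open>f\<close> and respects
  doubling, so its increments from 0 along any line are dyadic and are determined by the derivative
  at 0.\<close>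

lemma orthogonally_additive_odd_part:
  fixes f :: "'a::euclidean_space \<Rightarrow> real"
  assumes f: "orthogonally_additive f" and dim: "2 \<le> DIM('a)"
    and L: "(f has_derivative L) (at 0)"
  shows "f x - f (- x) = 2 * L x"
proof -
  define g where "g y = f y - f (- y)" for y
  have "orthogonally_additive g"
    using orthogonally_additiveD[OF f] orthogonally_additiveD[OF f, of "- y" "- z" for y z]
    by (auto simp: orthogonally_additive_def g_def orthogonal_def)
  then have double: "g (2 *\<^sub>R y) = 2 * g y" for y
    by (rule orthogonally_additive_odd_double[OF _ _ dim]) (simp add: g_def)
  interpret L: bounded_linear L
    using L by (rule has_derivative_bounded_linear)
  have line: "((\<lambda>t. f (t *\<^sub>R y)) has_derivative (\<lambda>t. L (t *\<^sub>R y))) (at 0)" for y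
    by (rule has_derivative_compose[where g = f]) (auto intro!: derivative_eq_intros L)
  \<comment> \<open>Along this line \<open>g\<close> is the difference of \<open>f\<close> in the
    directions \<open>x\<close> and \<open>- x\<close>; linearity of \<open>L\<close> makes the
    slope \<open>2 * L x\<close>.\<close>
  have "((\<lambda>t. g (t *\<^sub>R x)) has_derivative (\<lambda>t. L (t *\<^sub>R x) - L (t *\<^sub>R (- x)))) (at 0)"
    unfolding g_def using has_derivative_diff[OF line[of x] line[of "- x"]] by simp
  then have "((\<lambda>t. g (t *\<^sub>R x)) has_real_derivative 2 * L x) (at 0)"
    by (rule has_derivative_imp_has_field_derivative) (simp add: L.scaleR L.neg)
  moreover have "g 0 = 0"
    by (simp add: g_def)
  then have "g ((0 + 1 / 2 ^ n) *\<^sub>R x) - g (0 *\<^sub>R x) = g x / 2 ^ n" for n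
    using halving_iterate[where g = g and x = x, OF double] by simp
  ultimately have "g x = (2 * L x) * 1"
    by (rule derivative_eq_dyadic_increment) simp
  then show ?thesis
    by (simp add: g_def)
qed

text \<open>With \<open>p\<close> and \<open>q\<close> the half sum and half difference,
  \<open>x = p + q\<close> and \<open>y = p - q\<close>. Equal norms make \<open>p\<close> and
  \<open>q\<close> orthogonal, and evenness hides the sign of \<open>q\<close>.\<close>

lemma orthogonally_additive_even_radial:
  fixes f :: "'a::real_inner \<Rightarrow> real"
  assumes f: "orthogonally_additive f" and even: "\<And>x. f (- x) = f x"
    and "norm x = norm y"
  shows "f x = f y"
proof -
  define p q where "p = (x + y) /\<^sub>R 2" and "q = (x - y) /\<^sub>R 2"
  have "x \<bullet> x = y \<bullet> y"
    using assms(3) by (simp add: norm_eq)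
  then have "p \<bullet> q = 0"
    by (simp add: p_def q_def inner_simps inner_commute)
  then have "f (p + q) = f (p + - q)"
    using orthogonally_additiveD[OF f, of p q] orthogonally_additiveD[OF f, of p "- q"] even
    by simp
  moreover have "p + q = x" "p + - q = y"
    by (simp_all add: p_def q_def scaleR_add_right scaleR_diff_right
        flip: scaleR_add_left)
  ultimately show ?thesis
    by simp
qed

lemma orthogonally_additive_even_quadratic:
  fixes f :: "'a::euclidean_space \<Rightarrow> real"
  assumes f: "orthogonally_additive f" and even: "\<And>x. f (- x) = f x"
    and dim: "2 \<le> DIM('a)" and diff: "\<And>x. f differentiable (at x)"
  obtains c where "\<And>x. f x = c * (norm x)\<^sup>2"
proof -
  \<comment> \<open>The vector \<open>u\<close> supplies one representative on every sphere;
    \<open>w\<close> is a second orthogonal direction, so that squared norms can be added by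
    Pythagoras.\<close>
  obtain u :: 'a where u: "norm u = 1"
    using vector_choose_size[of 1] by auto
  obtain w where w: "u \<bullet> w = 0" "norm w = 1"
    using exists_orthogonal_same_norm[OF dim, of u] u by metis
  define g where "g s = f (sqrt s *\<^sub>R u)" for s
  have f_g: "f x = g ((norm x)\<^sup>2)" for x
    unfolding g_def by (rule orthogonally_additive_even_radial[OF f even]) (simp add: u)
  \<comment> \<open>Since \<open>sqrt\<close> is odd and \<open>f\<close> is even, \<open>g\<close>
    takes the same value at \<open>s\<close> and \<open>- s\<close>; additivity is thus claimed for
    nonnegative arguments.\<close>
  have add: "g (s + t) = g s + g t" if "s \<ge> 0" "t \<ge> 0" for s t
  proof -
    have orth: "(sqrt s *\<^sub>R u) \<bullet> (sqrt t *\<^sub>R w) = 0"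
      using w by simp
    have "(norm (sqrt s *\<^sub>R u + sqrt t *\<^sub>R w))\<^sup>2 = s + t"
      using norm_add_Pythagorean[of "sqrt s *\<^sub>R u" "sqrt t *\<^sub>R w"] orth that u w(2)
      by (simp add: orthogonal_def)
    then have "g (s + t) = f (sqrt s *\<^sub>R u + sqrt t *\<^sub>R w)"
      by (simp add: f_g)
    also have "\<dots> = f (sqrt s *\<^sub>R u) + f (sqrt t *\<^sub>R w)"
      by (rule orthogonally_additiveD[OF f orth])
    finally show ?thesis
      using that u w by (simp add: f_g)
  qed
  have halve: "g (s / 2 ^ n) = g s / 2 ^ n" if "s \<ge> 0" for s n
  proof (induction n)
    case (Suc n)
    have "g (s / 2 ^ n) = 2 * g (s / 2 ^ Suc n)"
      using add[of "s / 2 ^ Suc n" "s / 2 ^ Suc n"] that by (simp add: field_simps)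
    then show ?case
      using Suc by (simp add: field_simps)
  qed simp
  \<comment> \<open>The base point is 1 because \<open>sqrt\<close> is not differentiable at 0.
    Additivity moves the increments there:
    \<open>g (1 + s / 2 ^ n) - g 1 = g s / 2 ^ n\<close>.\<close>
  have "(\<lambda>s. sqrt s *\<^sub>R u) differentiable (at 1)"
    by (intro differentiable_scaleR differentiable_const)
      (use DERIV_real_sqrt[of 1] in \<open>auto simp: differentiable_def has_field_derivative_def\<close>)
  then have "g differentiable (at 1)"
    unfolding g_def by (rule differentiable_chain_at[unfolded o_def, OF _ diff])
  then obtain c where c: "(g has_real_derivative c) (at 1)"
    by (auto simp: real_differentiable_def)
  have "g s = c * s" if "s > 0" for s
    by (rule derivative_eq_dyadic_increment[OF c])
      (use that halve[of s] add[of 1 "s / 2 ^ n" for n] in auto)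
  moreover have "g 0 = 0"
    using add[of 0 0] by simp
  ultimately have "g ((norm x)\<^sup>2) = c * (norm x)\<^sup>2" for x
    by (cases "x = 0") auto
  then show ?thesis
    by (intro that[of c]) (simp add: f_g)
qed

theorem orthogonally_additive_differentiable:
  fixes f :: "'a::euclidean_space \<Rightarrow> real"
  assumes f: "orthogonally_additive f" and dim: "2 \<le> DIM('a)"
    and diff: "\<And>x. f differentiable (at x)"
  obtains b c where "\<And>x. f x = b \<bullet> x + c * (norm x)\<^sup>2"
proof -
  obtain L where L: "(f has_derivative L) (at 0)"
    using diff by (auto simp: differentiable_def)
  define h where "h x = f x + f (- x)" for x
  have "orthogonally_additive h"
    using orthogonally_additiveD[OF f] orthogonally_additiveD[OF f, of "- y" "- z" for y z]
    by (auto simp: orthogonally_additive_def h_def orthogonal_def)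
  moreover have "h differentiable (at x)" for x
    unfolding h_def
    by (intro differentiable_add diff differentiable_compose[OF diff]) simp
  ultimately obtain c where c: "\<And>x. h x = c * (norm x)\<^sup>2"
    using orthogonally_additive_even_quadratic[of h] dim by (auto simp: h_def add.commute)
  have "linear L"
    using L has_derivative_linear by blast
  \<comment> \<open>The vector \<open>adjoint L 1\<close> is the Riesz representative of the
    functional \<open>L\<close>.\<close>
  then have b: "L x = adjoint L 1 \<bullet> x" for x
    using adjoint_works[of L x 1] by (simp add: inner_commute)
  \<comment> \<open>Half the sum of \<open>f x + f (- x)\<close> and \<open>f x - f (- x)\<close>;
    as \<open>h\<close> is twice the even part, its constant \<open>c\<close> is halved.\<close>
  have "f x = adjoint L 1 \<bullet> x + c / 2 * (norm x)\<^sup>2" for x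
    using c[of x] orthogonally_additive_odd_part[OF f dim L, of x] b[of x]
    by (simp add: h_def field_simps)
  then show ?thesis
    by (rule that)
qed

theorem proposition2p3:
  fixes \<phi> :: "real ^ 3 \<Rightarrow> real"
  assumes "C1 \<phi>"
    and "\<And>n v w :: real ^ 3. n \<in> sphere 0 1 \<Longrightarrow>
           \<phi> (v - ((v - w) \<bullet> n) *\<^sub>R n) + \<phi> (w + ((v - w) \<bullet> n) *\<^sub>R n) = \<phi> v + \<phi> w"
  shows "\<exists>(a::real) (b::real ^ 3) (c::real). \<forall>v. \<phi> v = a + b \<bullet> v + c * (norm v)\<^sup>2"
proof -
  define f where "f x = \<phi> x - \<phi> 0" for x
  \<comment> \<open>The hypothesis with \<open>n = sgn x\<close> sends the pair
    \<open>x + y\<close>, \<open>0\<close> to \<open>y\<close>, \<open>x\<close>, because the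
    component of \<open>x + y\<close> along \<open>n\<close> is \<open>x\<close>. The case
    \<open>x = 0\<close> is separate since \<open>sgn 0 = 0\<close> is not a unit vector.\<close>
  have add: "\<phi> (x + y) + \<phi> 0 = \<phi> x + \<phi> y" if "x \<bullet> y = 0" for x y
  proof (cases "x = 0")
    case False
    have "(x + y) \<bullet> sgn x = norm x"
      using that False
      by (simp add: sgn_div_norm inner_add_left inner_commute[of y] dot_square_norm power2_eq_square)
    then have "((x + y - 0) \<bullet> sgn x) *\<^sub>R sgn x = x"
      using False by (simp add: sgn_div_norm)
    moreover have "sgn x \<in> sphere 0 1"
      using False by (simp add: norm_sgn)
    ultimately show ?thesis
      using assms(2)[of "sgn x" "x + y" 0] by (simp only: add_0_left add_diff_cancel_left') (simp add: add.commute)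
  qed simp
  have "orthogonally_additive f"
    unfolding orthogonally_additive_def
  proof (intro allI impI)
    fix x y :: "real ^ 3"
    assume "orthogonal x y"
    then show "f (x + y) = f x + f y"
      using add[of x y] unfolding f_def orthogonal_def by linarith
  qed
  moreover have "f differentiable (at x)" for x
  proof -
    obtain D where "(\<phi> has_derivative blinfun_apply (D x)) (at x)"
      using assms(1) unfolding C1_def by blast
    then have "\<phi> differentiable (at x)"
      by (rule differentiableI)
    then show ?thesis
      unfolding f_def by (intro differentiable_diff differentiable_const)
  qed
  ultimately obtain b c where "\<And>x. f x = b \<bullet> x + c * (norm x)\<^sup>2"
    using orthogonally_additive_differentiable[of f] by auto
  then have "\<phi> v = \<phi> 0 + b \<bullet> v + c * (norm v)\<^sup>2" for v
    unfolding f_def by (metis add.assoc add.commute diff_add_cancel)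
  then show ?thesis
    by blast
qed

end
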